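(* Let $Y\subset\mathbb{R}^m$ and $\mathcal{W}\subset\mathbb{R}^q$ be compact, convex and nonempty, and consider $\mathcal{Q}(x)=\min_{y\in Y}f(y,x)$, $x\in\mathbb{R}^n$, where $f$ has the saddle point representation $$f(y,x)=x^\top a_1+y^\top a_2+\max_{w\in\mathcal{W}}\big[y^\top A_0w+x^\top B_0w-\phi_0(w)\big],$$ with $a_1\in\mathbb{R}^n$, $a_2\in\mathbb{R}^m$, $A_0\in\mathbb{R}^{m\times q}$, $B_0\in\mathbb{R}^{n\times q}$ and $\phi_0$ convex, proper and lower semicontinuous. Set $$L_x(y,w)=y^\top(a_2+A_0w)+x^\top B_0w-\phi_0(w),\qquad \theta_x(w)=\min_{y\in Y}L_x(y,w).$$ Let $\bar x\in X$, let $\hat w\in\mathcal{W}$ be an $\varepsilon$-optimal solution of $\max_{w\in\mathcal{W}}\theta_{\bar x}(w)$, and let $\hat y\in Y$ be a $\tau$-optimal solution of $\min_{y\in Y}L_{\bar x}(y,\hat w)$. Then the affine function $$\mathcal{C}(x)=x^\top(a_1+B_0\hat w)+\hat y^\top(a_2+A_0\hat w)-\phi_0(\hat w)-\tau$$ is an $(\varepsilon+\tau)$-inexact cut for $\mathcal{Q}$ at $\bar x$.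
   Context: Definition ($\varepsilon$-inexact cut). Let $\mathcal{Q}:X\to\mathbb{R}$ be a convex function with $X\subset\mathbb{R}^n$ convex, $X\subset\mathrm{ri}(\mathrm{dom}(\mathcal{Q}))$, and let $\varepsilon\ge0$. A function $\mathcal{C}:X\to\mathbb{R}$ is an $\varepsilon$-inexact cut for $\mathcal{Q}$ at $\bar x\in X$ if $\mathcal{C}$ is affine, $\mathcal{Q}(x)\ge\mathcal{C}(x)$ for all $x\in X$, and $\mathcal{Q}(\bar x)-\mathcal{C}(\bar x)\le\varepsilon$. For $\varepsilon\ge 0$, an $\varepsilon$-optimal solution of a minimization (resp. maximization) problem is a feasible point whose objective value is at most the optimal value plus $\varepsilon$ (resp. at least the optimal value minus $\varepsilon$); here $\varepsilon,\tau\ge0$. The function $f$ takes values in $\,]-\infty,+\infty]$ (so $\mathcal{W}$ meets the domain of $\phi_0$). *)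

theory Defs
  imports "HOL-Analysis.Analysis"
begin

text \<open>
  Functions with values in the extended reals are modelled as functions into \<open>ereal\<close>.
  Minima and maxima are rendered as infima and suprema in this complete lattice; in the
  situation of the theorem (compact nonempty index sets and semicontinuous objectives)
  they are attained.
\<close>

definition eff_dom :: "('a \<Rightarrow> ereal) \<Rightarrow> 'a set" where
  "eff_dom g = {x. g x < \<infinity>}"

definition proper_fun :: "('a \<Rightarrow> ereal) \<Rightarrow> bool" where
  "proper_fun g \<longleftrightarrow> (\<forall>x. g x \<noteq> -\<infinity>) \<and> eff_dom g \<noteq> {}"

text \<open>The library notion \<open>convex_on\<close> covers only real-valued functions, so convexity of an
  extended-valued function is expressed by convexity of its epigraph, which avoids the
  undefined sum of \<open>\<infinity>\<close> and \<open>-\<infinity>\<close>.\<close>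

definition convex_ereal_fun :: "('a::real_vector \<Rightarrow> ereal) \<Rightarrow> bool" where
  "convex_ereal_fun g \<longleftrightarrow> convex {(x, r). g x \<le> ereal r}"

definition lower_semicont :: "('a::topological_space \<Rightarrow> ereal) \<Rightarrow> bool" where
  "lower_semicont g \<longleftrightarrow> (\<forall>x. \<forall>a < g x. \<forall>\<^sub>F z in nhds x. a < g z)"

definition eps_optimal_min :: "'a set \<Rightarrow> ('a \<Rightarrow> ereal) \<Rightarrow> real \<Rightarrow> 'a \<Rightarrow> bool" where
  "eps_optimal_min S g \<epsilon> x \<longleftrightarrow> x \<in> S \<and> g x \<le> (INF z\<in>S. g z) + ereal \<epsilon>"

definition eps_optimal_max :: "'a set \<Rightarrow> ('a \<Rightarrow> ereal) \<Rightarrow> real \<Rightarrow> 'a \<Rightarrow> bool" where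
  "eps_optimal_max S g \<epsilon> x \<longleftrightarrow> x \<in> S \<and> g x \<ge> (SUP z\<in>S. g z) - ereal \<epsilon>"

definition affine_fun_on :: "'a::euclidean_space set \<Rightarrow> ('a \<Rightarrow> real) \<Rightarrow> bool" where
  "affine_fun_on X C \<longleftrightarrow> (\<exists>a b. \<forall>x\<in>X. C x = x \<bullet> a + b)"

text \<open>The conjuncts up to \<open>0 \<le> \<epsilon>\<close> are the standing requirements under which the notion of an
  inexact cut is defined: \<open>Q\<close> is real-valued and convex on the convex set \<open>X\<close>, which lies in
  the relative interior of the domain of \<open>Q\<close>, and \<open>\<epsilon>\<close> is nonnegative. They are part of the
  predicate, so asserting that a function is an inexact cut includes asserting them.\<close>

definition inexact_cut ::
    "'a::euclidean_space set \<Rightarrow> ('a \<Rightarrow> ereal) \<Rightarrow> ('a \<Rightarrow> real) \<Rightarrow> real \<Rightarrow> 'a \<Rightarrow> bool" where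
  "inexact_cut X Q C \<epsilon> xbar \<longleftrightarrow>
     convex X \<and>
     (\<forall>x\<in>X. \<bar>Q x\<bar> \<noteq> \<infinity>) \<and>
     convex_on X (\<lambda>x. real_of_ereal (Q x)) \<and>
     X \<subseteq> rel_interior (eff_dom Q) \<and>
     0 \<le> \<epsilon> \<and>
     xbar \<in> X \<and>
     affine_fun_on X C \<and>
     (\<forall>x\<in>X. ereal (C x) \<le> Q x) \<and>
     Q xbar - ereal (C xbar) \<le> ereal \<epsilon>"

end

theory Submission
  imports Defs
begin

text \<open>
  Write \<open>E\<close> for the part of the epigraph of \<open>\<phi>\<^sub>0\<close> above \<open>W\<close>, that is, the pairs \<open>(w, r)\<close> with
  \<open>w \<in> W\<close> and \<open>\<phi>\<^sub>0 w \<le> r\<close>. It is convex, and \<open>f y x \<le> c\<close> holds iff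
  \<open>x \<bullet> (a\<^sub>1 + B\<^sub>0 w) + y \<bullet> (a\<^sub>2 + A\<^sub>0 w) - r \<le> c\<close> for every \<open>(w, r)\<close> in \<open>E\<close>. Working with \<open>E\<close> instead of
  with \<open>\<phi>\<^sub>0\<close> turns every statement about the supremum into one about a family of real affine
  functions.

  The standing requirements on \<open>Q\<close> follow from this description: \<open>f\<close> is jointly convex, as a
  supremum of affine functions, so its partial infimum \<open>Q\<close> is convex. Compactness of \<open>W\<close> and
  lower semicontinuity of \<open>\<phi>\<^sub>0\<close> bound the supremum from above, while one point of \<open>E\<close> and
  compactness of \<open>Y\<close> bound \<open>Q\<close> from below. So \<open>Q\<close> is finite on the whole space, and the relative
  interior of its domain is the whole space.

  The cut is valid by weak duality: inserting \<open>what\<close> into the supremum bounds \<open>f y x\<close> from below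
  by \<open>x \<bullet> a\<^sub>1 + L\<^sub>x(y, what)\<close>. The dependence of this bound on \<open>x\<close> does not involve \<open>y\<close>, hence
  \<open>yhat\<close>, which is \<open>\<tau>\<close>-optimal at \<open>xbar\<close>, is \<open>\<tau>\<close>-optimal at every \<open>x\<close>.

  The gap at \<open>xbar\<close> is controlled by strong duality, \<open>min\<^sub>y max\<^sub>w L \<le> max\<^sub>w min\<^sub>y L\<close>. Since
  \<open>L\<close> is affine in \<open>y\<close>, this needs no general minimax theorem: it follows from one separation
  of convex sets in the space of pairs (slope, intercept) of affine functions of \<open>y\<close>
  (\<open>minimax_affine_family\<close>).
\<close>

section \<open>A minimax theorem for convex families of affine functions\<close>

text \<open>
  A pair \<open>(u, s)\<close> encodes the affine function \<open>y \<mapsto> y \<bullet> u + s\<close>. The family \<open>H\<close> is disjoint from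
  the convex set \<open>P\<close> of the affine functions that exceed \<open>c\<close> on all of \<open>Y\<close>. A hyperplane
  separating them cannot be vertical, because \<open>P\<close> contains functions of every slope (\<open>Y\<close> is bounded); so, up to
  scaling, its normal is \<open>(q, 1)\<close>, and the separating functional is evaluation at the point
  \<open>q\<close>. Were \<open>q\<close> outside \<open>Y\<close>, a function exceeding \<open>c\<close> on \<open>Y\<close> could be made arbitrarily
  negative at \<open>q\<close>, contradicting the separation.
\<close>
lemma minimax_affine_family:
  fixes Y :: "'a::euclidean_space set" and H :: "('a \<times> real) set"
  assumes Y: "compact Y" "convex Y" "Y \<noteq> {}"
    and H: "convex H"
    and le: "\<And>u s. (u, s) \<in> H \<Longrightarrow> \<exists>y\<in>Y. y \<bullet> u + s \<le> c"
  shows "\<exists>q\<in>Y. \<forall>(u, s)\<in>H. q \<bullet> u + s \<le> c"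
proof (cases "H = {}")
  case True
  then show ?thesis using Y by auto
next
  case False
  define P where "P = {z. \<forall>y\<in>Y. y \<bullet> fst z + snd z > c}"
  have "P = (\<Inter>y\<in>Y. {z. (y, 1) \<bullet> z > c})"
    by (auto simp: P_def inner_prod_def)
  then have "convex P"
    by (simp add: convex_INT convex_halfspace_gt)
  moreover have const: "(0, c + t) \<in> P" if "t > 0" for t
    using that by (simp add: P_def)
  have "P \<noteq> {}"
    using const[of 1] by auto
  moreover have "H \<inter> P = {}"
    using le by (force simp: P_def)
  ultimately obtain n b where n: "n \<noteq> 0"
    and Hb: "\<forall>z\<in>H. n \<bullet> z \<le> b" and Pb: "\<forall>z\<in>P. n \<bullet> z \<ge> b"
    using separating_hyperplane_sets[OF H _ False, of P] by metis
  obtain p \<alpha> where n_eq: "n = (p, \<alpha>)"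
    by (cases n)
  have Pb': "p \<bullet> u + \<alpha> * s \<ge> b" if "(u, s) \<in> P" for u s
    using Pb that by (fastforce simp: n_eq)
  have above: "\<alpha> * (c + t) \<ge> b" if "t > 0" for t
    using Pb'[OF const[OF that]] by simp
  have "\<alpha> \<ge> 0"
  proof (rule ccontr)
    assume neg: "\<not> \<alpha> \<ge> 0"
    \<comment> \<open>Large enough that \<open>\<alpha> * (c + t) \<le> b - 1\<close>; the maximum ensures \<open>t > 0\<close>.\<close>
    define t where "t = max 1 ((b - 1 - \<alpha> * c) / \<alpha>)"
    have "\<alpha> * t \<le> b - 1 - \<alpha> * c"
      using neg by (simp add: t_def field_simps max_def split: if_splits)
    moreover have "\<alpha> * (c + t) \<ge> b"
      by (rule above) (simp add: t_def)
    ultimately show False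
      by (simp add: algebra_simps)
  qed
  moreover have "\<alpha> \<noteq> 0"
  proof
    assume "\<alpha> = 0"
    have slope: "p \<bullet> u \<ge> b" for u
    proof -
      have "continuous_on Y (\<lambda>y. y \<bullet> u)"
        by (intro continuous_intros)
      from continuous_attains_inf[OF Y(1,3) this]
      obtain y0 where "\<forall>y\<in>Y. y0 \<bullet> u \<le> y \<bullet> u"
        by auto
      then have "(u, c + 1 - y0 \<bullet> u) \<in> P"
        by (force simp: P_def)
      from Pb'[OF this] \<open>\<alpha> = 0\<close> show ?thesis
        by simp
    qed
    have "p \<noteq> 0"
      using n n_eq \<open>\<alpha> = 0\<close> by (simp add: zero_prod_def)
    \<comment> \<open>A multiple of \<open>p\<close> at which \<open>p \<bullet> u\<close> has the value \<open>b - 1\<close>.\<close>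
    then show False
      using slope[of "((b - 1) / (p \<bullet> p)) *\<^sub>R p"] by simp
  qed
  ultimately have \<alpha>: "\<alpha> > 0"
    by simp
  define q where "q = p /\<^sub>R \<alpha>"
  have Hq: "q \<bullet> u + s \<le> b / \<alpha>" if "(u, s) \<in> H" for u s
  proof -
    have "p \<bullet> u + \<alpha> * s \<le> b"
      using Hb that by (fastforce simp: n_eq)
    moreover have "q \<bullet> u + s = (p \<bullet> u + \<alpha> * s) / \<alpha>"
      using \<alpha> by (simp add: q_def field_simps)
    ultimately show ?thesis
      using \<alpha> by (simp add: divide_right_mono)
  qed
  have Pq: "q \<bullet> u + s \<ge> b / \<alpha>" if "(u, s) \<in> P" for u s
  proof -
    have "q \<bullet> u + s = (p \<bullet> u + \<alpha> * s) / \<alpha>"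
      using \<alpha> by (simp add: q_def field_simps)
    then show ?thesis
      using Pb'[OF that] \<alpha> by (simp add: divide_right_mono)
  qed
  have bc: "b / \<alpha> \<le> c"
    by (rule field_le_epsilon) (use Pq[OF const] in simp)
  have "q \<in> Y"
  proof (rule ccontr)
    assume "q \<notin> Y"
    then obtain a \<beta> where q\<beta>: "a \<bullet> q < \<beta>" and Y\<beta>: "\<forall>y\<in>Y. a \<bullet> y > \<beta>"
      using separating_hyperplane_closed_point[OF Y(2) compact_imp_closed[OF Y(1)]] by metis
    have small: "b / \<alpha> \<le> c - t * (\<beta> - a \<bullet> q)" if "t > 0" for t
    proof -
      have "c < y \<bullet> (t *\<^sub>R a) + (c - t * \<beta>)" if "y \<in> Y" for y
      proof -
        have "\<beta> < y \<bullet> a"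
          using Y\<beta> that by (metis inner_commute)
        with \<open>t > 0\<close> show ?thesis
          by simp
      qed
      \<comment> \<open>The function \<open>y \<mapsto> c + t * (a \<bullet> y - \<beta>)\<close>, which is below \<open>c\<close> at \<open>q\<close> by a multiple of \<open>t\<close>.\<close>
      then have "(t *\<^sub>R a, c - t * \<beta>) \<in> P"
        by (simp add: P_def)
      from Pq[OF this] show ?thesis
        by (simp add: algebra_simps inner_commute)
    qed
    define t where "t = (c - b / \<alpha> + 1) / (\<beta> - a \<bullet> q)"
    have "t > 0"
      using bc q\<beta> by (simp add: t_def)
    moreover have "t * (\<beta> - a \<bullet> q) = c - b / \<alpha> + 1"
      using q\<beta> by (simp add: t_def)
    ultimately show False
      using small[of t] by simp
  qed
  moreover have "\<forall>(u, s)\<in>H. q \<bullet> u + s \<le> c"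
    using Hq bc by fastforce
  ultimately show ?thesis
    by blast
qed

section \<open>Extended-real-valued convex functions\<close>

lemma lower_semicont_bounded_below:
  fixes g :: "'a::topological_space \<Rightarrow> ereal"
  assumes "compact W" and lsc: "lower_semicont g" and "\<And>w. g w \<noteq> -\<infinity>"
  shows "\<exists>m::real. \<forall>w\<in>W. ereal m \<le> g w"
proof -
  define U where "U n = {w. ereal (- real n) < g w}" for n :: nat
  have "open (U n)" for n
  proof (subst open_subopen, intro ballI)
    fix w
    assume "w \<in> U n"
    then have "\<forall>\<^sub>F z in nhds w. ereal (- real n) < g z"
      using lsc by (simp add: U_def lower_semicont_def)
    then show "\<exists>T. open T \<and> w \<in> T \<and> T \<subseteq> U n"
      unfolding eventually_nhds U_def by blast
  qed
  moreover have "W \<subseteq> (\<Union>n. U n)"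
  proof
    fix w
    obtain n :: nat where "ereal (- real n) < g w"
    proof (cases "g w")
      case (real r)
      obtain n :: nat where "- r < real n"
        using reals_Archimedean2 by blast
      with real show thesis
        by (intro that[of n]) simp
    qed (use assms(3) that in auto)
    then show "w \<in> (\<Union>n. U n)"
      by (auto simp: U_def)
  qed
  ultimately obtain N where N: "finite N" "W \<subseteq> (\<Union>n\<in>N. U n)"
    using compactE_image[OF assms(1), of UNIV U] by metis
  have "ereal (- real (Max (insert 0 N))) \<le> g w" if "w \<in> W" for w
  proof -
    obtain n where n: "n \<in> N" "ereal (- real n) < g w"
      using N(2) \<open>w \<in> W\<close> by (auto simp: U_def)
    have "n \<le> Max (insert 0 N)"
      using N(1) n(1) by simp
    then have "ereal (- real (Max (insert 0 N))) \<le> ereal (- real n)"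
      by simp
    with n(2) show ?thesis
      by order
  qed
  then show ?thesis
    by blast
qed

text \<open>
  Replacing \<open>\<phi> w\<close> by all its real upper bounds removes the extended reals from the right-hand
  side: a point with \<open>\<phi> w = \<infinity>\<close> contributes \<open>-\<infinity>\<close> to the supremum and has no real upper bound.
\<close>
lemma SUP_minus_le_iff:
  fixes \<phi> :: "'a \<Rightarrow> ereal"
  assumes "\<And>w. \<phi> w \<noteq> -\<infinity>"
  shows "(SUP w\<in>W. ereal (k w) - \<phi> w) \<le> ereal c \<longleftrightarrow>
         (\<forall>w\<in>W. \<forall>r. \<phi> w \<le> ereal r \<longrightarrow> k w - r \<le> c)"
proof -
  have "ereal (k w) - \<phi> w \<le> ereal c \<longleftrightarrow> (\<forall>r. \<phi> w \<le> ereal r \<longrightarrow> k w - r \<le> c)" for w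
    using assms[of w] by (cases "\<phi> w") force+
  then show ?thesis
    by (simp add: SUP_le_iff)
qed

text \<open>
  The infimum need not be attained, so points of the epigraph above \<open>x\<close> are taken within an
  arbitrary \<open>e > 0\<close> of it before they are combined.
\<close>
lemma convex_on_partial_INF:
  fixes f :: "'b::real_vector \<Rightarrow> 'a::real_vector \<Rightarrow> ereal"
  assumes "convex Y" and "convex X"
    and epi: "convex {((y, x), r). f y x \<le> ereal r}"
    and fin: "\<And>x. x \<in> X \<Longrightarrow> \<bar>INF y\<in>Y. f y x\<bar> \<noteq> \<infinity>"
  shows "convex_on X (\<lambda>x. real_of_ereal (INF y\<in>Y. f y x))"
proof (rule convex_onI)
  define q where "q x = real_of_ereal (INF y\<in>Y. f y x)" for x
  have q: "(INF y\<in>Y. f y x) = ereal (q x)" if "x \<in> X" for x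
    using fin[OF that] by (simp add: q_def ereal_real)
  fix t :: real and x1 x2
  assume t: "0 < t" "t < 1" and x: "x1 \<in> X" "x2 \<in> X"
  define x where "x = (1 - t) *\<^sub>R x1 + t *\<^sub>R x2"
  have "x \<in> X"
    using t x assms(2) by (simp add: x_def convexD_alt)
  have near: "\<exists>y\<in>Y. f y z \<le> ereal (q z + e)" if "z \<in> X" "e > 0" for z e
  proof -
    have "(INF y\<in>Y. f y z) < ereal (q z + e)"
      using q that by simp
    then show ?thesis
      by (auto simp: INF_less_iff intro: less_imp_le)
  qed
  have "q x \<le> (1 - t) * q x1 + t * q x2"
  proof (rule field_le_epsilon)
    fix e :: real
    assume "e > 0"
    obtain y1 where y1: "y1 \<in> Y" "f y1 x1 \<le> ereal (q x1 + e)"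
      using near[OF x(1) \<open>e > 0\<close>] by blast
    obtain y2 where y2: "y2 \<in> Y" "f y2 x2 \<le> ereal (q x2 + e)"
      using near[OF x(2) \<open>e > 0\<close>] by blast
    define y where "y = (1 - t) *\<^sub>R y1 + t *\<^sub>R y2"
    have "(1 - t) *\<^sub>R ((y1, x1), q x1 + e) + t *\<^sub>R ((y2, x2), q x2 + e)
        \<in> {((y, x), r). f y x \<le> ereal r}"
      by (rule convexD_alt[OF epi]) (use y1 y2 t in auto)
    then have "f y x \<le> ereal ((1 - t) * (q x1 + e) + t * (q x2 + e))"
      by (simp add: x_def y_def)
    moreover have "y \<in> Y"
      using t y1(1) y2(1) assms(1) by (simp add: y_def convexD_alt)
    then have "ereal (q x) \<le> f y x"
      unfolding q[OF \<open>x \<in> X\<close>, symmetric] by (rule INF_lower)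
    ultimately have "ereal (q x) \<le> ereal ((1 - t) * (q x1 + e) + t * (q x2 + e))"
      by order
    then show "q x \<le> (1 - t) * q x1 + t * q x2 + e"
      by (simp add: algebra_simps)
  qed
  then show "real_of_ereal (INF y\<in>Y. f y ((1 - t) *\<^sub>R x1 + t *\<^sub>R x2))
      \<le> (1 - t) * real_of_ereal (INF y\<in>Y. f y x1) + t * real_of_ereal (INF y\<in>Y. f y x2)"
    by (simp add: q_def x_def)
qed (rule assms(2))

section \<open>Inexact cuts from approximate primal-dual solutions\<close>

theorem proposition3p1:
  fixes X :: "(real ^ 'n) set"
    and Y :: "(real ^ 'm) set"
    and W :: "(real ^ 'q) set"
    and f :: "real ^ 'm \<Rightarrow> real ^ 'n \<Rightarrow> ereal"
    and Q :: "real ^ 'n \<Rightarrow> ereal"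
    and a\<^sub>1 :: "real ^ 'n" and a\<^sub>2 :: "real ^ 'm"
    and A\<^sub>0 :: "real ^ 'q ^ 'm" and B\<^sub>0 :: "real ^ 'q ^ 'n"
    and \<phi>\<^sub>0 :: "real ^ 'q \<Rightarrow> ereal"
    and L :: "real ^ 'n \<Rightarrow> real ^ 'm \<Rightarrow> real ^ 'q \<Rightarrow> ereal"
    and \<theta> :: "real ^ 'n \<Rightarrow> real ^ 'q \<Rightarrow> ereal"
    and xbar :: "real ^ 'n" and yhat :: "real ^ 'm" and what :: "real ^ 'q"
    and \<epsilon> \<tau> :: real
  assumes "compact Y" and "convex Y" and "Y \<noteq> {}"
    and "compact W" and "convex W" and "W \<noteq> {}"
    and "convex_ereal_fun \<phi>\<^sub>0" and "proper_fun \<phi>\<^sub>0" and "lower_semicont \<phi>\<^sub>0"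
    and f_gt_MInf: "\<And>y x. f y x \<noteq> -\<infinity>"
    and f_saddle: "\<And>y x. f y x = ereal (x \<bullet> a\<^sub>1 + y \<bullet> a\<^sub>2) +
          (SUP w\<in>W. ereal (y \<bullet> (A\<^sub>0 *v w) + x \<bullet> (B\<^sub>0 *v w)) - \<phi>\<^sub>0 w)"
    and Q_eq: "\<And>x. Q x = (INF y\<in>Y. f y x)"
    and L_eq: "\<And>x y w. L x y w =
          ereal (y \<bullet> (a\<^sub>2 + A\<^sub>0 *v w) + x \<bullet> (B\<^sub>0 *v w)) - \<phi>\<^sub>0 w"
    and \<theta>_eq: "\<And>x w. \<theta> x w = (INF y\<in>Y. L x y w)"
    and "convex X" and "xbar \<in> X"
    and "0 \<le> \<epsilon>" and "0 \<le> \<tau>"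
    and "eps_optimal_max W (\<theta> xbar) \<epsilon> what"
    and "eps_optimal_min Y (\<lambda>y. L xbar y what) \<tau> yhat"
  shows "\<bar>\<phi>\<^sub>0 what\<bar> \<noteq> \<infinity> \<and>
    inexact_cut X Q
      (\<lambda>x. x \<bullet> (a\<^sub>1 + B\<^sub>0 *v what) + yhat \<bullet> (a\<^sub>2 + A\<^sub>0 *v what)
            - real_of_ereal (\<phi>\<^sub>0 what) - \<tau>)
      (\<epsilon> + \<tau>) xbar"
proof -
  have \<phi>_gt: "\<phi>\<^sub>0 w \<noteq> -\<infinity>" for w
    using \<open>proper_fun \<phi>\<^sub>0\<close> by (simp add: proper_fun_def)
  obtain m where m: "\<And>w. w \<in> W \<Longrightarrow> ereal m \<le> \<phi>\<^sub>0 w"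
    using lower_semicont_bounded_below[OF \<open>compact W\<close> \<open>lower_semicont \<phi>\<^sub>0\<close>] \<phi>_gt by blast
  have f_le: "f y x \<le> ereal c \<longleftrightarrow> (\<forall>w\<in>W. \<forall>r. \<phi>\<^sub>0 w \<le> ereal r \<longrightarrow>
      x \<bullet> (a\<^sub>1 + B\<^sub>0 *v w) + y \<bullet> (a\<^sub>2 + A\<^sub>0 *v w) - r \<le> c)" for x y c
  proof -
    define S where "S = (SUP w\<in>W. ereal (y \<bullet> (A\<^sub>0 *v w) + x \<bullet> (B\<^sub>0 *v w)) - \<phi>\<^sub>0 w)"
    have "f y x \<le> ereal c \<longleftrightarrow> S \<le> ereal (c - (x \<bullet> a\<^sub>1 + y \<bullet> a\<^sub>2))"
      unfolding f_saddle S_def[symmetric] by (cases S) auto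
    then show ?thesis
      unfolding S_def SUP_minus_le_iff[of \<phi>\<^sub>0, OF \<phi>_gt]
      by (simp add: algebra_simps)
  qed
  have f_ge: "ereal (x \<bullet> (a\<^sub>1 + B\<^sub>0 *v w) + y \<bullet> (a\<^sub>2 + A\<^sub>0 *v w) - r) \<le> f y x"
    if "w \<in> W" "\<phi>\<^sub>0 w \<le> ereal r" for w r x y
  proof (cases "f y x")
    case (real v)
    then show ?thesis
      using f_le[of y x v] that by simp
  qed (use f_gt_MInf[of y x] in auto)

  \<comment> \<open>Otherwise every term of the supremum would be \<open>-\<infinity>\<close>, and so would \<open>f\<close>.\<close>
  have "\<exists>w\<in>W. \<phi>\<^sub>0 w \<noteq> \<infinity>"
  proof (rule ccontr)
    assume "\<not> (\<exists>w\<in>W. \<phi>\<^sub>0 w \<noteq> \<infinity>)"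
    then have "f y x \<le> ereal c" for y x c
      unfolding f_le by auto
    then have "f 0 0 = -\<infinity>"
      by (intro ereal_bot)
    then show False
      using f_gt_MInf by blast
  qed
  then obtain w0 r0 where w0: "w0 \<in> W" "\<phi>\<^sub>0 w0 = ereal r0"
    using \<phi>_gt by (metis ereal_cases)

  have bounded_below_Y: "\<exists>b. \<forall>y\<in>Y. b \<le> y \<bullet> v" for v
  proof -
    have "continuous_on Y (\<lambda>y. y \<bullet> v)"
      by (intro continuous_intros)
    from continuous_attains_inf[OF \<open>compact Y\<close> \<open>Y \<noteq> {}\<close> this] show ?thesis
      by blast
  qed
  have Q_fin: "\<bar>Q x\<bar> \<noteq> \<infinity>" for x
  proof -
    obtain b where b: "\<And>y. y \<in> Y \<Longrightarrow> b \<le> y \<bullet> (a\<^sub>2 + A\<^sub>0 *v w0)"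
      using bounded_below_Y by blast
    have "ereal (x \<bullet> (a\<^sub>1 + B\<^sub>0 *v w0) + b - r0) \<le> f y x" if "y \<in> Y" for y
    proof -
      have "ereal (x \<bullet> (a\<^sub>1 + B\<^sub>0 *v w0) + b - r0)
          \<le> ereal (x \<bullet> (a\<^sub>1 + B\<^sub>0 *v w0) + y \<bullet> (a\<^sub>2 + A\<^sub>0 *v w0) - r0)"
        using b[OF that] by simp
      also have "\<dots> \<le> f y x"
        by (rule f_ge) (use w0 in auto)
      finally show ?thesis .
    qed
    then have lower: "ereal (x \<bullet> (a\<^sub>1 + B\<^sub>0 *v w0) + b - r0) \<le> Q x"
      unfolding Q_eq by (rule INF_greatest)
    obtain y where "y \<in> Y"
      using \<open>Y \<noteq> {}\<close> by blast
    have "continuous_on W (\<lambda>w. x \<bullet> (a\<^sub>1 + B\<^sub>0 *v w) + y \<bullet> (a\<^sub>2 + A\<^sub>0 *v w))"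
      by (intro continuous_intros matrix_vector_mult_linear_continuous_on)
    from continuous_attains_sup[OF \<open>compact W\<close> \<open>W \<noteq> {}\<close> this]
    obtain k where k: "\<And>w. w \<in> W \<Longrightarrow> x \<bullet> (a\<^sub>1 + B\<^sub>0 *v w) + y \<bullet> (a\<^sub>2 + A\<^sub>0 *v w) \<le> k"
      by blast
    have "f y x \<le> ereal (k - m)"
      unfolding f_le
    proof (intro ballI allI impI)
      fix w r
      assume "w \<in> W" "\<phi>\<^sub>0 w \<le> ereal r"
      then have "ereal m \<le> ereal r"
        using m by (meson order_trans)
      then show "x \<bullet> (a\<^sub>1 + B\<^sub>0 *v w) + y \<bullet> (a\<^sub>2 + A\<^sub>0 *v w) - r \<le> k - m"
        using k[OF \<open>w \<in> W\<close>] by simp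
    qed
    moreover have "Q x \<le> f y x"
      unfolding Q_eq using \<open>y \<in> Y\<close> by (rule INF_lower)
    ultimately have "Q x \<le> ereal (k - m)"
      by order
    with lower show ?thesis
      by (cases "Q x") auto
  qed
  have "Q x < \<infinity>" for x
    using Q_fin[of x] by (cases "Q x") auto
  then have "eff_dom Q = UNIV"
    by (simp add: eff_dom_def)
  then have domain: "X \<subseteq> rel_interior (eff_dom Q)"
    by simp

  have "{((y, x), r). f y x \<le> ereal r} =
      (\<Inter>(w, s)\<in>{(w, s). w \<in> W \<and> \<phi>\<^sub>0 w \<le> ereal s}.
        {z. ((a\<^sub>2 + A\<^sub>0 *v w, a\<^sub>1 + B\<^sub>0 *v w), -1) \<bullet> z \<le> s})"
    by (auto simp: f_le inner_commute algebra_simps)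
  then have epigraph: "convex {((y, x), r). f y x \<le> ereal r}"
    by (auto intro!: convex_INT convex_halfspace_le)
  have Q_convex: "convex_on X (\<lambda>x. real_of_ereal (Q x))"
    unfolding Q_eq
    by (rule convex_on_partial_INF[OF \<open>convex Y\<close> \<open>convex X\<close> epigraph])
      (use Q_fin in \<open>simp add: Q_eq\<close>)

  have what: "what \<in> W" and what_opt: "(SUP w\<in>W. \<theta> xbar w) - ereal \<epsilon> \<le> \<theta> xbar what"
    using \<open>eps_optimal_max W (\<theta> xbar) \<epsilon> what\<close> by (auto simp: eps_optimal_max_def)
  have yhat: "yhat \<in> Y" and yhat_opt: "L xbar yhat what \<le> \<theta> xbar what + ereal \<tau>"
    using \<open>eps_optimal_min Y (\<lambda>y. L xbar y what) \<tau> yhat\<close>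
    by (auto simp: eps_optimal_min_def \<theta>_eq)

  \<comment> \<open>The dual value is above \<open>-\<infinity>\<close> at \<open>w0\<close>, so the best one is, too. At \<open>what\<close> it would be \<open>-\<infinity>\<close> if \<open>\<phi>\<^sub>0 what = \<infinity>\<close>.\<close>
  have \<phi>_fin: "\<bar>\<phi>\<^sub>0 what\<bar> \<noteq> \<infinity>"
  proof
    assume "\<bar>\<phi>\<^sub>0 what\<bar> = \<infinity>"
    then have "\<phi>\<^sub>0 what = \<infinity>"
      using \<phi>_gt by auto
    then have "L xbar yhat what = -\<infinity>"
      by (simp add: L_eq)
    moreover have "\<theta> xbar what \<le> L xbar yhat what"
      unfolding \<theta>_eq using yhat by (rule INF_lower)
    ultimately have "\<theta> xbar what = -\<infinity>"
      by simp
    then have "(SUP w\<in>W. \<theta> xbar w) = -\<infinity>"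
      using what_opt by (cases "SUP w\<in>W. \<theta> xbar w") auto
    moreover have "\<theta> xbar w0 \<le> (SUP w\<in>W. \<theta> xbar w)"
      using w0(1) by (rule SUP_upper)
    moreover obtain b where "\<And>y. y \<in> Y \<Longrightarrow> b \<le> y \<bullet> (a\<^sub>2 + A\<^sub>0 *v w0)"
      using bounded_below_Y by blast
    then have "ereal (b + xbar \<bullet> (B\<^sub>0 *v w0) - r0) \<le> \<theta> xbar w0"
      unfolding \<theta>_eq L_eq w0(2) by (intro INF_greatest) simp
    ultimately show False
      by simp
  qed
  then obtain r where r: "\<phi>\<^sub>0 what = ereal r"
    by (cases "\<phi>\<^sub>0 what") auto
  define l where "l = yhat \<bullet> (a\<^sub>2 + A\<^sub>0 *v what) + xbar \<bullet> (B\<^sub>0 *v what) - r"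
  have L_hat: "L xbar yhat what = ereal l"
    by (simp add: L_eq r l_def)

  define C where "C x = x \<bullet> (a\<^sub>1 + B\<^sub>0 *v what) + yhat \<bullet> (a\<^sub>2 + A\<^sub>0 *v what)
            - real_of_ereal (\<phi>\<^sub>0 what) - \<tau>" for x
  have C_affine: "affine_fun_on X C"
    unfolding affine_fun_on_def C_def
    by (intro exI[of _ "a\<^sub>1 + B\<^sub>0 *v what"]
        exI[of _ "yhat \<bullet> (a\<^sub>2 + A\<^sub>0 *v what) - real_of_ereal (\<phi>\<^sub>0 what) - \<tau>"]) simp

  \<comment> \<open>In the optimality of \<open>yhat\<close> the terms that depend on \<open>xbar\<close> cancel.\<close>
  have yhat_le: "yhat \<bullet> (a\<^sub>2 + A\<^sub>0 *v what) - \<tau> \<le> y \<bullet> (a\<^sub>2 + A\<^sub>0 *v what)" if "y \<in> Y" for y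
  proof -
    have "L xbar yhat what \<le> L xbar y what + ereal \<tau>"
      using yhat_opt INF_lower[OF that, of "\<lambda>y. L xbar y what"]
      unfolding \<theta>_eq by (meson add_right_mono order_trans)
    then show ?thesis
      by (simp add: L_eq r)
  qed
  have C_le: "ereal (C x) \<le> Q x" for x
    unfolding Q_eq
  proof (rule INF_greatest)
    fix y
    assume "y \<in> Y"
    then have "ereal (C x) \<le> ereal (x \<bullet> (a\<^sub>1 + B\<^sub>0 *v what) + y \<bullet> (a\<^sub>2 + A\<^sub>0 *v what) - r)"
      using yhat_le by (fastforce simp: C_def r)
    also have "\<dots> \<le> f y x"
      by (rule f_ge) (use what r in auto)
    finally show "ereal (C x) \<le> f y x" .
  qed

  \<comment> \<open>\<open>l\<close> is at least the dual value at \<open>what\<close>, which is within \<open>\<epsilon>\<close> of the best one.\<close>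
  have \<theta>_le: "\<theta> xbar w \<le> ereal (l + \<epsilon>)" if "w \<in> W" for w
  proof -
    have "\<theta> xbar what \<le> ereal l"
      unfolding L_hat[symmetric] \<theta>_eq using yhat by (rule INF_lower)
    then have "(SUP w\<in>W. \<theta> xbar w) - ereal \<epsilon> \<le> ereal l"
      using what_opt by order
    then have "(SUP w\<in>W. \<theta> xbar w) \<le> ereal (l + \<epsilon>)"
      by (cases "SUP w\<in>W. \<theta> xbar w") auto
    then show ?thesis
      using SUP_upper[OF that, of "\<theta> xbar"] by order
  qed
  \<comment> \<open>The image of \<open>E\<close> under \<open>h\<close>, shifted by \<open>(a\<^sub>2, 0)\<close>, consists of the affine functions
    \<open>y \<mapsto> L xbar y w\<close> and those obtained by lowering their intercepts. Lowering changes neither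
    supremum over \<open>w\<close>, and it makes the family convex: it is an affine image of an epigraph.\<close>
  define E where "E = (W \<times> UNIV) \<inter> {(w, s). \<phi>\<^sub>0 w \<le> ereal s}"
  define h where "h = (\<lambda>(w, s). (A\<^sub>0 *v w, xbar \<bullet> (B\<^sub>0 *v w) - s))"
  have "convex E"
    unfolding E_def using \<open>convex W\<close> \<open>convex_ereal_fun \<phi>\<^sub>0\<close>
    by (intro convex_Int convex_Times) (auto simp: convex_ereal_fun_def)
  moreover have "linear h"
    by (rule linearI)
      (auto simp: h_def matrix_vector_right_distrib inner_add_right
        matrix_vector_mult_scaleR algebra_simps split: prod.splits)
  ultimately have "convex ((+) (a\<^sub>2, 0) ` h ` E)"
    by (simp add: convex_linear_image convex_translation)
  moreover have "\<exists>y\<in>Y. y \<bullet> u + s \<le> l + \<epsilon>" if mem: "(u, s) \<in> (+) (a\<^sub>2, 0) ` h ` E" for u s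
  proof -
    obtain w t where w: "w \<in> W" "\<phi>\<^sub>0 w \<le> ereal t"
      and us: "u = a\<^sub>2 + A\<^sub>0 *v w" "s = xbar \<bullet> (B\<^sub>0 *v w) - t"
      using mem by (auto simp: E_def h_def)
    have "continuous_on Y (\<lambda>y. y \<bullet> u)"
      by (intro continuous_intros)
    from continuous_attains_inf[OF \<open>compact Y\<close> \<open>Y \<noteq> {}\<close> this]
    obtain y where y: "y \<in> Y" "\<And>z. z \<in> Y \<Longrightarrow> y \<bullet> u \<le> z \<bullet> u"
      by blast
    have "ereal (y \<bullet> u + s) \<le> \<theta> xbar w"
      unfolding \<theta>_eq
    proof (rule INF_greatest)
      fix z
      assume "z \<in> Y"
      then have "y \<bullet> u \<le> z \<bullet> u"
        by (rule y(2))
      then show "ereal (y \<bullet> u + s) \<le> L xbar z w"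
        using w(2) \<phi>_gt[of w] by (cases "\<phi>\<^sub>0 w") (auto simp: L_eq us)
    qed
    also have "\<dots> \<le> ereal (l + \<epsilon>)"
      using w(1) by (rule \<theta>_le)
    finally show ?thesis
      using y(1) by auto
  qed
  ultimately obtain q where q: "q \<in> Y"
    and q_le: "\<forall>(u, s)\<in>(+) (a\<^sub>2, 0) ` h ` E. q \<bullet> u + s \<le> l + \<epsilon>"
    using minimax_affine_family[OF \<open>compact Y\<close> \<open>convex Y\<close> \<open>Y \<noteq> {}\<close>] by meson
  have "Q xbar \<le> f q xbar"
    unfolding Q_eq using q by (rule INF_lower)
  also have "\<dots> \<le> ereal (xbar \<bullet> a\<^sub>1 + l + \<epsilon>)"
    unfolding f_le
  proof (intro ballI allI impI)
    fix w t
    assume "w \<in> W" "\<phi>\<^sub>0 w \<le> ereal t"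
    then have "(w, t) \<in> E"
      by (simp add: E_def)
    then have "q \<bullet> (a\<^sub>2 + A\<^sub>0 *v w) + (xbar \<bullet> (B\<^sub>0 *v w) - t) \<le> l + \<epsilon>"
      using q_le by (force simp: h_def)
    then show "xbar \<bullet> (a\<^sub>1 + B\<^sub>0 *v w) + q \<bullet> (a\<^sub>2 + A\<^sub>0 *v w) - t \<le> xbar \<bullet> a\<^sub>1 + l + \<epsilon>"
      by (simp add: inner_add_right)
  qed
  also have "xbar \<bullet> a\<^sub>1 + l + \<epsilon> = C xbar + (\<epsilon> + \<tau>)"
    by (simp add: C_def l_def r inner_add_right)
  finally have "Q xbar - ereal (C xbar) \<le> ereal (\<epsilon> + \<tau>)"
    by (cases "Q xbar") auto
  then have "inexact_cut X Q C (\<epsilon> + \<tau>) xbar"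
    unfolding inexact_cut_def
    using \<open>convex X\<close> \<open>xbar \<in> X\<close> \<open>0 \<le> \<epsilon>\<close> \<open>0 \<le> \<tau>\<close> Q_fin Q_convex domain C_affine C_le by simp
  then show ?thesis
    using \<phi>_fin unfolding C_def by blast
qed

end
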